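(* Let $n\ge 4$ and let $a^n=(a_1,\dots,a_n)$ be a vector of positive link lengths. Then: (1) For every circular configuration $\beta^{n-1}=(\beta_1,\dots,\beta_{n-1})\in\mathcal{CC}^{\mathrm{onf}}(a^n)$, its diagonal vector $(L_2(\beta^2),\dots,L_{n-2}(\beta^{n-2}))$ is contained in the diagonal space $\mathcal{DS}(a^n)$. (2) Conversely, for every $L^{n-3}=(L_2,\dots,L_{n-2})\in\mathcal{DS}(a^n)$ there exists a circular configuration $\beta^{n-1}\in\mathcal{CC}^{\mathrm{onf}}(a^n)$ having these diagonal lengths, i.e. $L_k(\beta^k)=L_k$ for all $2\le k\le n-2$. (3) Moreover, for a circular configuration $\beta^{n-1}$ with diagonal lengths $L_k=L_k(\beta^k)$, the angle $\beta_k$ is related to the angles $\beta^{k-1}=(\beta_1,\dots,\beta_{k-1})$, for each $1\le k\le n-1$, by $$2a_kL_{k-1}\sin\bigl(\beta_k+\Phi_{k-1}(\beta^{k-1})\bigr)=L_k^2-a_k^2-L_{k-1}^2$$ whenever $\Phi_{k-1}(\beta^{k-1})$ is defined, and, if it is not defined, by $$2a_k\sin(\beta_k)\,Y_{k-1}(\beta^{k-1})+2a_k\cos(\beta_k)\,X_{k-1}(\beta^{k-1})+L_{k-1}^2=L_k^2-a_k^2 .$$ For $k=1$ one sets $L_0:=0$ and $\Phi_0:=0$, so that the relation imposes no condition on $\beta_1$ and $\beta_1$ is an arbitrary angle.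
   Context: Angles are identified with points of the circle $S^1$ (i.e. taken modulo $2\pi$). For $1\le k\le n-1$ and $\beta^k=(\beta_1,\dots,\beta_k)\in(S^1)^k$ put $$X_k(\beta^k)=\sum_{i=1}^k a_i\cos\beta_i,\qquad Y_k(\beta^k)=\sum_{i=1}^k a_i\sin\beta_i,\qquad L_k(\beta^k)=\sqrt{X_k(\beta^k)^2+Y_k(\beta^k)^2};$$ $L_k(\beta^k)$ is called the $k$-th diagonal length. The set of circular configurations is $$\mathcal{CC}^{\mathrm{onf}}(a^n)=\Bigl\{\beta^{n-1}\in(S^1)^{n-1}: \Bigl\|\sum_{j=1}^{n-1}a_j(\cos\beta_j,\sin\beta_j)\Bigr\|_2^2=a_n^2\Bigr\}.$$ Thus for a circular configuration $L_1(\beta^1)=a_1$ and $L_{n-1}(\beta^{n-1})=a_n$; accordingly $L_1:=a_1$ and $L_{n-1}:=a_n$ are always fixed, and the variable diagonals are $L^{n-3}=(L_2,\dots,L_{n-2})$. For $(a,b)\in\mathbb{R}^2\setminus\{(0,0)\}$, $\varphi(a,b)$ denotes the angle between the positive $x$-axis and the vector from the origin to the point $(a,b)$, so that $a\sin x+b\cos x=\sqrt{a^2+b^2}\,\sin(x+\varphi(a,b))$ for all $x$. Put $\Phi_k(\beta^k)=\varphi\bigl(Y_k(\beta^k),X_k(\beta^k)\bigr)$ (note the order of the arguments), which is defined when $(X_k(\beta^k),Y_k(\beta^k))\ne(0,0)$. For $1\le k\le n-1$ put $$\mathrm{R}_k^{\min}=\max\Bigl\{0,\ \max_{1\le i\le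 k}\Bigl(2a_i-\sum_{j=1}^k a_j\Bigr)\Bigr\},\qquad \mathrm{R}_k^{\max}=\sum_{j=1}^k a_j .$$ The diagonal space $\mathcal{DS}(a^n)$ is the set of all $L^{n-3}=(L_2,\dots,L_{n-2})\in\mathbb{R}_{\ge0}^{n-3}$ such that, with $L_{n-1}:=a_n$, $$L_{n-k-1}\in\bigl[\,|L_{n-k}-a_{n-k}|,\ L_{n-k}+a_{n-k}\bigr]\cap\bigl[\mathrm{R}_{n-k-1}^{\min},\ \mathrm{R}_{n-k-1}^{\max}\bigr]\qquad\text{for all }1\le k\le n-3 .$$ *)

theory Defs
  imports "HOL-Analysis.Analysis"
begin

text \<open>Angles are real numbers modulo \<open>2\<pi>\<close>, so this type is the circle \<open>S\<^sup>1\<close>.\<close>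

definition angle_eq :: "real \<Rightarrow> real \<Rightarrow> bool" where
  "angle_eq x y \<longleftrightarrow> (\<exists>m::int. x = y + of_int m * (2 * pi))"

lemma equivp_angle_eq: "equivp angle_eq"
proof (rule equivpI)
  show "reflp angle_eq"
    by (rule reflpI) (auto simp: angle_eq_def intro: exI[of _ 0])
  show "symp angle_eq"
  proof (rule sympI)
    fix x y assume "angle_eq x y"
    then obtain m :: int where "x = y + of_int m * (2 * pi)" by (auto simp: angle_eq_def)
    then have "y = x + of_int (- m) * (2 * pi)" by simp
    then show "angle_eq y x" unfolding angle_eq_def by blast
  qed
  show "transp angle_eq"
  proof (rule transpI)
    fix x y z assume "angle_eq x y" "angle_eq y z"
    then obtain m l :: int where "x = y + of_int m * (2 * pi)" "y = z + of_int l * (2 * pi)"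
      by (auto simp: angle_eq_def)
    then have "x = z + of_int (m + l) * (2 * pi)" by (simp add: algebra_simps)
    then show "angle_eq x z" unfolding angle_eq_def by blast
  qed
qed

quotient_type angle = real / angle_eq
  morphisms rep_angle to_angle
  by (rule equivp_angle_eq)

lift_definition cos_angle :: "angle \<Rightarrow> real" is cos
  by (auto simp: angle_eq_def cos_add mult.commute[of _ "2 * pi"])

lift_definition sin_angle :: "angle \<Rightarrow> real" is sin
  by (auto simp: angle_eq_def sin_add mult.commute[of _ "2 * pi"])

instantiation angle :: "{zero, plus}"
begin

lift_definition zero_angle :: angle is 0 .

lift_definition plus_angle :: "angle \<Rightarrow> angle \<Rightarrow> angle" is "(+)"
proof -
  fix x x' y y' :: real assume "angle_eq x x'" "angle_eq y y'"
  then obtain m l :: int where "x = x' + of_int m * (2 * pi)" "y = y' + of_int l * (2 * pi)"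
    by (auto simp: angle_eq_def)
  then have "x + y = (x' + y') + of_int (m + l) * (2 * pi)" by (simp add: algebra_simps)
  then show "angle_eq (x + y) (x' + y')" unfolding angle_eq_def by blast
qed

instance ..

end

text \<open>A vector \<open>(v\<^sub>p, \<dots>, v\<^sub>q)\<close> is a function on \<open>nat\<close>, read on the indices \<open>p, \<dots>, q\<close>.
  Elements of the configuration and diagonal spaces are extensional functions, so that
  they correspond one-to-one to such vectors.\<close>

definition X_coord :: "(nat \<Rightarrow> real) \<Rightarrow> (nat \<Rightarrow> angle) \<Rightarrow> nat \<Rightarrow> real" where
  "X_coord a \<beta> k = (\<Sum>i=1..k. a i * cos_angle (\<beta> i))"

definition Y_coord :: "(nat \<Rightarrow> real) \<Rightarrow> (nat \<Rightarrow> angle) \<Rightarrow> nat \<Rightarrow> real" where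
  "Y_coord a \<beta> k = (\<Sum>i=1..k. a i * sin_angle (\<beta> i))"

definition diag_length :: "(nat \<Rightarrow> real) \<Rightarrow> (nat \<Rightarrow> angle) \<Rightarrow> nat \<Rightarrow> real" where
  "diag_length a \<beta> k = sqrt ((X_coord a \<beta> k)\<^sup>2 + (Y_coord a \<beta> k)\<^sup>2)"

definition CConf :: "nat \<Rightarrow> (nat \<Rightarrow> real) \<Rightarrow> (nat \<Rightarrow> angle) set" where
  "CConf n a = {\<beta> \<in> {1..n-1} \<rightarrow>\<^sub>E UNIV.
     (norm (\<Sum>j=1..n-1. a j *\<^sub>R (cos_angle (\<beta> j), sin_angle (\<beta> j))))\<^sup>2 = (a n)\<^sup>2}"

definition diag_vector :: "nat \<Rightarrow> (nat \<Rightarrow> real) \<Rightarrow> (nat \<Rightarrow> angle) \<Rightarrow> nat \<Rightarrow> real" where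
  "diag_vector n a \<beta> = (\<lambda>k\<in>{2..n-2}. diag_length a \<beta> k)"

text \<open>The variable diagonals \<open>(L\<^sub>2, \<dots>, L\<^bsub>n-2\<^esub>)\<close> completed by the fixed values
  \<open>L\<^sub>0 = 0\<close>, \<open>L\<^sub>1 = a\<^sub>1\<close> and \<open>L\<^bsub>n-1\<^esub> = a\<^sub>n\<close>.\<close>

definition all_diags :: "nat \<Rightarrow> (nat \<Rightarrow> real) \<Rightarrow> (nat \<Rightarrow> real) \<Rightarrow> nat \<Rightarrow> real" where
  "all_diags n a L = L(0 := 0, 1 := a 1, n - 1 := a n)"

definition polar_angle :: "real \<Rightarrow> real \<Rightarrow> angle" where
  "polar_angle x y = to_angle (Arg (Complex x y))"

text \<open>\<open>None\<close> means that \<open>\<Phi>\<^sub>k\<close> is undefined; \<open>\<Phi>\<^sub>0 = 0\<close> by convention.\<close>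

definition Phi :: "(nat \<Rightarrow> real) \<Rightarrow> (nat \<Rightarrow> angle) \<Rightarrow> nat \<Rightarrow> angle option" where
  "Phi a \<beta> k =
     (if k = 0 then Some 0
      else if (X_coord a \<beta> k, Y_coord a \<beta> k) = (0, 0) then None
      else Some (polar_angle (Y_coord a \<beta> k) (X_coord a \<beta> k)))"

definition angle_relation ::
    "(nat \<Rightarrow> real) \<Rightarrow> (nat \<Rightarrow> real) \<Rightarrow> (nat \<Rightarrow> angle) \<Rightarrow> nat \<Rightarrow> bool" where
  "angle_relation a L \<beta> k \<longleftrightarrow>
     (case Phi a \<beta> (k - 1) of
        Some \<phi> \<Rightarrow>
          2 * a k * L (k - 1) * sin_angle (\<beta> k + \<phi>) = (L k)\<^sup>2 - (a k)\<^sup>2 - (L (k - 1))\<^sup>2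
      | None \<Rightarrow>
          2 * a k * sin_angle (\<beta> k) * Y_coord a \<beta> (k - 1)
          + 2 * a k * cos_angle (\<beta> k) * X_coord a \<beta> (k - 1) + (L (k - 1))\<^sup>2
          = (L k)\<^sup>2 - (a k)\<^sup>2)"

definition R_min :: "(nat \<Rightarrow> real) \<Rightarrow> nat \<Rightarrow> real" where
  "R_min a k = max 0 (Max ((\<lambda>i. 2 * a i - (\<Sum>j=1..k. a j)) ` {1..k}))"

definition R_max :: "(nat \<Rightarrow> real) \<Rightarrow> nat \<Rightarrow> real" where
  "R_max a k = (\<Sum>j=1..k. a j)"

definition diag_space :: "nat \<Rightarrow> (nat \<Rightarrow> real) \<Rightarrow> (nat \<Rightarrow> real) set" where
  "diag_space n a = {L \<in> {2..n-2} \<rightarrow>\<^sub>E {0..}.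
     \<forall>k\<in>{1..n-3}.
       L (n-k-1) \<in> {\<bar>all_diags n a L (n-k) - a (n-k)\<bar> .. all_diags n a L (n-k) + a (n-k)}
                   \<inter> {R_min a (n-k-1) .. R_max a (n-k-1)}}"

end

theory Submission
  imports Defs
begin

text \<open>
  Identify the plane with \<open>\<complex>\<close>. The first \<open>k\<close> links, laid end to end from the origin, reach
  the point \<open>z\<^sub>k = a\<^sub>1 cis \<beta>\<^sub>1 + \<dots> + a\<^sub>k cis \<beta>\<^sub>k\<close>, whose coordinates are \<open>X\<^sub>k\<close> and \<open>Y\<^sub>k\<close>, so the diagonal
  length \<open>L\<^sub>k\<close> is \<open>\<bar>z\<^sub>k\<bar>\<close>, and \<open>z\<^bsub>k+1\<^esub> = z\<^sub>k + a\<^bsub>k+1\<^esub> cis \<beta>\<^bsub>k+1\<^esub>\<close>.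
  Everything follows from this recursion.

  The triangle inequality for \<open>z\<^sub>k, z\<^bsub>k+1\<^esub>\<close> and the new link gives the interval conditions of the
  diagonal space, and the triangle inequality for a single link against the sum of the others gives
  the bound \<open>R\<^sup>m\<^sup>i\<^sup>n\<close>. Conversely, the triangle inequalities suffice to append one link: as the
  link turns through half a circle, starting from the direction of \<open>z\<^sub>k\<close>, the length of
  \<open>z\<^bsub>k+1\<^esub>\<close> runs continuously from the sum to the absolute difference of the two lengths
  (lemma \<open>link_to_distance\<close>), so a chain with prescribed diagonals can be built link by link
  (\<open>chain_with_diagonals\<close>). The only triangle that is not listed explicitly in the diagonal space
  has the sides \<open>a\<^sub>1, a\<^sub>2, L\<^sub>2\<close>; its inequalities are exactly
  \<open>R\<^sub>2\<^sup>m\<^sup>i\<^sup>n \<le> L\<^sub>2 \<le> R\<^sub>2\<^sup>m\<^sup>a\<^sup>x\<close>.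

  The relation between \<open>\<beta>\<^sub>k\<close> and the earlier angles is the law of cosines for
  \<open>\<bar>z\<^bsub>k-1\<^esub> + a\<^sub>k cis \<beta>\<^sub>k\<bar>\<^sup>2\<close>. Finally, \<open>\<beta>\<^sub>1\<close> is arbitrary because a rotation of the whole chain
  multiplies every \<open>z\<^sub>k\<close> by the same unit complex number.
\<close>

section \<open>The chain in the complex plane\<close>

lift_definition cis_angle :: "angle \<Rightarrow> complex" is cis
  by (auto simp: angle_eq_def complex_eq_iff cos_add sin_add mult.commute[of _ "2 * pi"])

lemma Re_cis_angle [simp]: "Re (cis_angle \<theta>) = cos_angle \<theta>"
  by transfer simp

lemma Im_cis_angle [simp]: "Im (cis_angle \<theta>) = sin_angle \<theta>"
  by transfer simp

lemma cmod_cis_angle [simp]: "cmod (cis_angle \<theta>) = 1"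
  by transfer simp

lemma cis_angle_add: "cis_angle (\<theta> + \<phi>) = cis_angle \<theta> * cis_angle \<phi>"
  by transfer (simp add: cis_mult)

lemma ex_angle_add: "\<exists>\<delta>. (\<phi>::angle) + \<delta> = \<theta>"
proof -
  have "\<phi> + to_angle (rep_angle \<theta> - rep_angle \<phi>) = to_angle (rep_angle \<phi> + (rep_angle \<theta> - rep_angle \<phi>))"
    by (metis plus_angle.abs_eq Quotient3_angle Quotient3_abs_rep)
  also have "\<dots> = \<theta>"
    using Quotient3_abs_rep[OF Quotient3_angle] by simp
  finally show ?thesis by blast
qed

definition chain_end :: "(nat \<Rightarrow> real) \<Rightarrow> (nat \<Rightarrow> angle) \<Rightarrow> nat \<Rightarrow> complex" where
  "chain_end a \<beta> k = (\<Sum>i=1..k. of_real (a i) * cis_angle (\<beta> i))"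

lemma chain_end_0 [simp]: "chain_end a \<beta> 0 = 0"
  by (simp add: chain_end_def)

lemma chain_end_Suc:
  "chain_end a \<beta> (Suc k) = chain_end a \<beta> k + of_real (a (Suc k)) * cis_angle (\<beta> (Suc k))"
  by (simp add: chain_end_def)

lemma Re_chain_end: "Re (chain_end a \<beta> k) = X_coord a \<beta> k"
  by (simp add: chain_end_def X_coord_def)

lemma Im_chain_end: "Im (chain_end a \<beta> k) = Y_coord a \<beta> k"
  by (simp add: chain_end_def Y_coord_def)

lemma diag_length_eq_cmod: "diag_length a \<beta> k = cmod (chain_end a \<beta> k)"
  by (simp add: diag_length_def cmod_def Re_chain_end Im_chain_end)

lemma chain_end_cong:
  assumes "\<And>i. i \<in> {1..k} \<Longrightarrow> \<beta> i = \<gamma> i"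
  shows "chain_end a \<beta> k = chain_end a \<gamma> k"
  using assms by (simp add: chain_end_def)

lemma chain_end_rotate:
  "chain_end a (\<lambda>i. \<beta> i + \<delta>) k = cis_angle \<delta> * chain_end a \<beta> k"
  by (simp add: chain_end_def cis_angle_add sum_distrib_left mult_ac)

lemma CConf_iff:
  assumes "0 \<le> a n"
  shows "\<beta> \<in> CConf n a \<longleftrightarrow>
    \<beta> \<in> {1..n-1} \<rightarrow>\<^sub>E UNIV \<and> cmod (chain_end a \<beta> (n - 1)) = a n"
proof -
  have "(\<Sum>j=1..n-1. a j *\<^sub>R (cos_angle (\<beta> j), sin_angle (\<beta> j)))
      = (X_coord a \<beta> (n - 1), Y_coord a \<beta> (n - 1))"
    by (simp add: X_coord_def Y_coord_def prod_eq_iff fst_sum snd_sum)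
  hence "norm (\<Sum>j=1..n-1. a j *\<^sub>R (cos_angle (\<beta> j), sin_angle (\<beta> j)))
      = cmod (chain_end a \<beta> (n - 1))"
    by (simp add: norm_Pair cmod_def Re_chain_end Im_chain_end)
  thus ?thesis using assms by (simp add: CConf_def)
qed

section \<open>Triangle inequalities for the diagonals\<close>

lemma cmod_chain_end_Suc_bounds:
  assumes "0 \<le> a (Suc k)"
  shows "\<bar>cmod (chain_end a \<beta> (Suc k)) - a (Suc k)\<bar> \<le> cmod (chain_end a \<beta> k)"
    and "cmod (chain_end a \<beta> k) \<le> cmod (chain_end a \<beta> (Suc k)) + a (Suc k)"
proof -
  let ?u = "of_real (a (Suc k)) * cis_angle (\<beta> (Suc k))"
  have u: "cmod ?u = a (Suc k)"
    using assms by (simp add: norm_mult)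
  show "\<bar>cmod (chain_end a \<beta> (Suc k)) - a (Suc k)\<bar> \<le> cmod (chain_end a \<beta> k)"
    using norm_triangle_ineq3[of "chain_end a \<beta> (Suc k)" ?u] u by (simp add: chain_end_Suc)
  show "cmod (chain_end a \<beta> k) \<le> cmod (chain_end a \<beta> (Suc k)) + a (Suc k)"
    using norm_triangle_ineq4[of "chain_end a \<beta> (Suc k)" ?u] u by (simp add: chain_end_Suc)
qed

lemma cmod_chain_end_le_R_max:
  assumes "\<And>i. i \<in> {1..k} \<Longrightarrow> 0 \<le> a i"
  shows "cmod (chain_end a \<beta> k) \<le> R_max a k"
  unfolding chain_end_def R_max_def
  by (rule sum_norm_le) (use assms in \<open>simp add: norm_mult\<close>)

text \<open>A link much longer than all the others together cannot be folded back to the origin: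
  the remaining links shorten it by at most their total length.\<close>

lemma R_min_le_cmod_chain_end:
  assumes "\<And>i. i \<in> {1..k} \<Longrightarrow> 0 \<le> a i" and "1 \<le> k"
  shows "R_min a k \<le> cmod (chain_end a \<beta> k)"
proof -
  have "2 * a i - (\<Sum>j=1..k. a j) \<le> cmod (chain_end a \<beta> k)" if i: "i \<in> {1..k}" for i
  proof -
    let ?u = "\<lambda>j. of_real (a j) * cis_angle (\<beta> j)"
    let ?rest = "\<Sum>j\<in>{1..k}-{i}. ?u j"
    have "chain_end a \<beta> k = ?u i + ?rest"
      unfolding chain_end_def using i by (simp add: sum.remove)
    hence "cmod (?u i) - cmod ?rest \<le> cmod (chain_end a \<beta> k)"
      using norm_diff_ineq[of "?u i" ?rest] by simp
    moreover have "cmod (?u i) = a i"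
      using assms i by (simp add: norm_mult)
    moreover have "cmod ?rest \<le> (\<Sum>j\<in>{1..k}-{i}. a j)"
      by (rule sum_norm_le) (use assms in \<open>simp add: norm_mult\<close>)
    moreover have "(\<Sum>j=1..k. a j) = a i + (\<Sum>j\<in>{1..k}-{i}. a j)"
      using i by (simp add: sum.remove)
    ultimately show ?thesis by simp
  qed
  thus ?thesis using assms(2) by (auto simp: R_min_def)
qed

section \<open>Building a chain from its diagonals\<close>

text \<open>The intermediate value theorem produces the direction, which keeps a degenerate triangle
  (even \<open>z = 0\<close>) from being a special case.\<close>

lemma link_to_distance:
  assumes "0 \<le> r" and "\<bar>cmod z - r\<bar> \<le> c" and "c \<le> cmod z + r"
  shows "\<exists>\<theta>. cmod (z + of_real r * cis_angle \<theta>) = c"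
proof -
  define g where "g t = cmod (z + of_real r * cis t)" for t
  have z: "z = of_real (cmod z) * cis (Arg z)"
    by (metis rcis_cmod_Arg rcis_def)
  have "z + of_real r * cis (Arg z) = of_real (cmod z + r) * cis (Arg z)"
    by (subst (1) z) (simp add: algebra_simps)
  hence straight: "g (Arg z) = cmod z + r"
    using assms(1) by (simp add: g_def norm_mult del: of_real_add)
  have "cis (Arg z + pi) = - cis (Arg z)"
    by (simp add: complex_eq_iff)
  hence "z + of_real r * cis (Arg z + pi) = of_real (cmod z - r) * cis (Arg z)"
    by (subst (1) z) (simp add: algebra_simps)
  hence folded: "g (Arg z + pi) = \<bar>cmod z - r\<bar>"
    by (simp add: g_def norm_mult del: of_real_diff)
  have "continuous_on {Arg z..Arg z + pi} g"
    unfolding g_def by (intro continuous_intros)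
  hence "\<exists>t\<ge>Arg z. t \<le> Arg z + pi \<and> g t = c"
    using assms straight folded by (intro IVT2') auto
  then obtain t where "g t = c" by blast
  hence "cmod (z + of_real r * cis_angle (to_angle t)) = c"
    by (simp add: g_def cis_angle.abs_eq)
  thus ?thesis by blast
qed

text \<open>Starting at the origin, with \<open>f 0 = 0\<close>, makes the first link an instance of the general
  step.\<close>

lemma chain_with_diagonals:
  assumes "f 0 = 0"
    and "\<And>k. k < m \<Longrightarrow> 0 \<le> a (Suc k)"
    and "\<And>k. k < m \<Longrightarrow> \<bar>f k - a (Suc k)\<bar> \<le> f (Suc k)"
    and "\<And>k. k < m \<Longrightarrow> f (Suc k) \<le> f k + a (Suc k)"
  shows "\<exists>\<beta>. \<forall>k\<le>m. cmod (chain_end a \<beta> k) = f k"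
  using assms(2-)
proof (induction m)
  case 0
  thus ?case using assms(1) by simp
next
  case (Suc m)
  then obtain \<beta> where \<beta>: "\<forall>k\<le>m. cmod (chain_end a \<beta> k) = f k" by (metis less_SucI)
  obtain \<theta> where \<theta>: "cmod (chain_end a \<beta> m + of_real (a (Suc m)) * cis_angle \<theta>) = f (Suc m)"
    using link_to_distance[of "a (Suc m)" "chain_end a \<beta> m" "f (Suc m)"] Suc.prems[of m] \<beta> by auto
  define \<gamma> where "\<gamma> = \<beta>(Suc m := \<theta>)"
  have same: "chain_end a \<gamma> k = chain_end a \<beta> k" if "k \<le> m" for k
    by (rule chain_end_cong) (use that in \<open>auto simp: \<gamma>_def\<close>)
  have "cmod (chain_end a \<gamma> k) = f k" if "k \<le> Suc m" for k
    using that same \<beta> \<theta> by (auto simp: le_Suc_eq chain_end_Suc \<gamma>_def)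
  thus ?case by blast
qed

text \<open>The interval conditions of the diagonal space bound \<open>L\<^sub>k\<close> in terms of \<open>L\<^bsub>k+1\<^esub>\<close>; the
  construction needs the same triangle inequalities as bounds on \<open>L\<^bsub>k+1\<^esub>\<close>.\<close>

lemma diag_space_triangle:
  assumes "4 \<le> n" and pos: "\<And>i. i \<in> {1..n} \<Longrightarrow> 0 < a i"
    and L: "L \<in> diag_space n a" and k: "k < n - 1"
  defines "f \<equiv> all_diags n a L"
  shows "\<bar>f k - a (Suc k)\<bar> \<le> f (Suc k) \<and> f (Suc k) \<le> f k + a (Suc k)"
proof -
  consider "k = 0" | "k = 1" | "2 \<le> k" by linarith
  thus ?thesis
  proof cases
    case 1
    \<comment> \<open>The first link joins the origin to a point at distance \<open>a\<^sub>1 = L\<^sub>1\<close>.\<close>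
    thus ?thesis using pos[of 1] assms(1) by (auto simp: f_def all_diags_def)
  next
    case 2
    have "\<forall>j\<in>{1..n-3}. L (n-j-1) \<in> {R_min a (n-j-1)..R_max a (n-j-1)}"
      using L by (auto simp: diag_space_def)
    from bspec[OF this, of "n - 3"] assms(1)
    have "R_min a 2 \<le> L 2" "L 2 \<le> R_max a 2"
      by (auto simp: numeral_2_eq_2 numeral_3_eq_3 Suc_diff_Suc)
    moreover have "{1..2::nat} = {1, 2}" by auto
    ultimately have "\<bar>a 1 - a 2\<bar> \<le> L 2" "L 2 \<le> a 1 + a 2"
      by (auto simp: R_min_def R_max_def)
    thus ?thesis using 2 assms(1) by (auto simp: f_def all_diags_def numeral_2_eq_2)
  next
    case 3
    define j where "j = n - k - 1"
    have j: "j \<in> {1..n-3}" "n - j - 1 = k" "n - j = Suc k"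
      using 3 k by (auto simp: j_def)
    have "L k \<in> {\<bar>f (Suc k) - a (Suc k)\<bar>..f (Suc k) + a (Suc k)}"
      using L j unfolding diag_space_def f_def by fastforce
    moreover have "f k = L k"
      using 3 k by (simp add: f_def all_diags_def)
    ultimately show ?thesis by auto
  qed
qed

section \<open>Diagonals of a circular configuration\<close>

lemma all_diags_diag_vector:
  assumes "4 \<le> n" and "\<And>i. i \<in> {1..n} \<Longrightarrow> 0 < a i"
    and "\<beta> \<in> CConf n a" and "k \<le> n - 1"
  shows "all_diags n a (diag_vector n a \<beta>) k = cmod (chain_end a \<beta> k)"
proof -
  have "cmod (chain_end a \<beta> (n - 1)) = a n"
    using assms CConf_iff[of a n \<beta>] by (simp add: less_imp_le)
  moreover have "cmod (chain_end a \<beta> 1) = a 1"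
    using assms(1) assms(2)[of 1] by (simp add: chain_end_def norm_mult)
  moreover consider "k = 0" | "k = 1" | "k = n - 1" | "k \<in> {2..n-2}"
    using assms(1,4) by fastforce
  ultimately show ?thesis
    using assms(1) by cases (auto simp: all_diags_def diag_vector_def diag_length_eq_cmod)
qed

lemma diag_vector_in_diag_space:
  assumes "4 \<le> n" and pos: "\<And>i. i \<in> {1..n} \<Longrightarrow> 0 < a i" and \<beta>: "\<beta> \<in> CConf n a"
  shows "diag_vector n a \<beta> \<in> diag_space n a"
proof -
  let ?D = "diag_vector n a \<beta>"
  have "?D \<in> {2..n-2} \<rightarrow>\<^sub>E {0..}"
    by (auto simp: diag_vector_def diag_length_eq_cmod)
  moreover have "?D (n-k-1) \<in>
      {\<bar>all_diags n a ?D (n-k) - a (n-k)\<bar>..all_diags n a ?D (n-k) + a (n-k)}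
        \<inter> {R_min a (n-k-1)..R_max a (n-k-1)}" if "k \<in> {1..n-3}" for k
  proof -
    define j where "j = n - k - 1"
    have j: "n - k - 1 = j" "n - k = Suc j" "j \<in> {2..n-2}" "Suc j \<le> n - 1"
      using that assms(1) by (auto simp: j_def)
    have nonneg: "0 \<le> a i" if "i \<in> {1..Suc j}" for i
      using pos[of i] that j(4) by (intro less_imp_le) auto
    have "?D j = cmod (chain_end a \<beta> j)"
      using j by (simp add: diag_vector_def diag_length_eq_cmod)
    moreover have "all_diags n a ?D (Suc j) = cmod (chain_end a \<beta> (Suc j))"
      using assms j by (intro all_diags_diag_vector) auto
    ultimately show ?thesis
      using cmod_chain_end_Suc_bounds[of a j \<beta>] cmod_chain_end_le_R_max[of j a \<beta>]
        R_min_le_cmod_chain_end[of j a \<beta>] nonneg j by auto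
  qed
  ultimately show ?thesis by (simp add: diag_space_def)
qed

lemma ex_CConf_with_diagonals:
  assumes "4 \<le> n" and pos: "\<And>i. i \<in> {1..n} \<Longrightarrow> 0 < a i" and L: "L \<in> diag_space n a"
  shows "\<exists>\<beta>\<in>CConf n a. \<forall>k\<in>{2..n-2}. diag_length a \<beta> k = L k"
proof -
  define f where "f = all_diags n a L"
  have "\<exists>\<beta>. \<forall>k\<le>n-1. cmod (chain_end a \<beta> k) = f k"
  proof (rule chain_with_diagonals)
    show "f 0 = 0" using assms(1) by (simp add: f_def all_diags_def)
    show "0 \<le> a (Suc k)" if "k < n - 1" for k
      using pos[of "Suc k"] that by (intro less_imp_le) auto
  qed (use diag_space_triangle[OF assms] in \<open>simp_all add: f_def\<close>)
  then obtain \<beta> where \<beta>: "cmod (chain_end a \<beta> k) = f k" if "k \<le> n - 1" for k by blast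
  define \<gamma> where "\<gamma> = restrict \<beta> {1..n-1}"
  have \<gamma>: "cmod (chain_end a \<gamma> k) = f k" if "k \<le> n - 1" for k
  proof -
    have "chain_end a \<gamma> k = chain_end a \<beta> k"
      by (rule chain_end_cong) (use that in \<open>auto simp: \<gamma>_def\<close>)
    thus ?thesis using \<beta> that by simp
  qed
  have "f (n - 1) = a n" by (simp add: f_def all_diags_def)
  hence "\<gamma> \<in> CConf n a"
    using \<gamma>[of "n - 1"] pos[of n] assms(1) by (simp add: CConf_iff less_imp_le \<gamma>_def)
  moreover have "diag_length a \<gamma> k = L k" if "k \<in> {2..n-2}" for k
    using \<gamma>[of k] that by (auto simp: diag_length_eq_cmod f_def all_diags_def)
  ultimately show ?thesis by blast
qed

section \<open>The relation between consecutive angles\<close>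

lemma cos_polar_angle: "cmod (Complex x y) * cos_angle (polar_angle x y) = x"
  using rcis_cmod_Arg[of "Complex x y"]
  by (metis Re_rcis complex.sel(1) cos_angle.abs_eq polar_angle_def)

lemma sin_polar_angle: "cmod (Complex x y) * sin_angle (polar_angle x y) = y"
  using rcis_cmod_Arg[of "Complex x y"]
  by (metis Im_rcis complex.sel(2) sin_angle.abs_eq polar_angle_def)

lemma sin_angle_add:
  "sin_angle (\<theta> + \<phi>) = sin_angle \<theta> * cos_angle \<phi> + cos_angle \<theta> * sin_angle \<phi>"
  by transfer (simp add: sin_add)

lemma cos_squared_plus_sin_squared_angle: "(cos_angle \<theta>)\<^sup>2 + (sin_angle \<theta>)\<^sup>2 = 1"
  by transfer simp

lemma law_of_cosines_angle:
  "(cmod (z + of_real r * cis_angle \<theta>))\<^sup>2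
    = (cmod z)\<^sup>2 + 2 * r * (sin_angle \<theta> * Im z + cos_angle \<theta> * Re z) + r\<^sup>2"
proof -
  have "(cmod (z + of_real r * cis_angle \<theta>))\<^sup>2 = (cmod z)\<^sup>2
      + 2 * r * (sin_angle \<theta> * Im z + cos_angle \<theta> * Re z)
      + r\<^sup>2 * ((cos_angle \<theta>)\<^sup>2 + (sin_angle \<theta>)\<^sup>2)"
    unfolding cmod_power2 by (simp add: power2_eq_square algebra_simps)
  thus ?thesis by (simp add: cos_squared_plus_sin_squared_angle)
qed

text \<open>The arguments of \<open>polar_angle\<close> in \<open>Phi\<close> are swapped, so for \<open>k \<ge> 1\<close> the angle \<open>\<Phi>\<^sub>k\<close> is
  the complement of the argument of \<open>z\<^sub>k\<close>; this is why the law of cosines appears with a sine.\<close>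

lemma chain_end_sin_add_Phi:
  assumes "Phi a \<beta> k = Some \<phi>"
  shows "cmod (chain_end a \<beta> k) * sin_angle (\<theta> + \<phi>)
    = sin_angle \<theta> * Y_coord a \<beta> k + cos_angle \<theta> * X_coord a \<beta> k"
proof (cases "k = 0")
  case True
  thus ?thesis by (simp add: X_coord_def Y_coord_def)
next
  case False
  define X Y where "X = X_coord a \<beta> k" and "Y = Y_coord a \<beta> k"
  have \<phi>: "\<phi> = polar_angle Y X"
    using assms False by (auto simp: Phi_def X_def Y_def split: if_splits)
  have len: "cmod (chain_end a \<beta> k) = cmod (Complex Y X)"
    by (simp add: cmod_def Re_chain_end Im_chain_end X_def Y_def add.commute)
  have "cmod (Complex Y X) * sin_angle (\<theta> + \<phi>)
      = sin_angle \<theta> * (cmod (Complex Y X) * cos_angle \<phi>)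
        + cos_angle \<theta> * (cmod (Complex Y X) * sin_angle \<phi>)"
    by (simp only: sin_angle_add) (simp only: algebra_simps)
  thus ?thesis by (simp only: len \<phi> cos_polar_angle sin_polar_angle X_def Y_def)
qed

lemma angle_relation_if_diagonals:
  assumes "1 \<le> k"
    and "L k = cmod (chain_end a \<beta> k)" and "L (k - 1) = cmod (chain_end a \<beta> (k - 1))"
  shows "angle_relation a L \<beta> k"
proof -
  obtain m where k: "k = Suc m" using assms(1) by (cases k) auto
  have law: "(L k)\<^sup>2 = (L m)\<^sup>2
      + 2 * a k * (sin_angle (\<beta> k) * Y_coord a \<beta> m + cos_angle (\<beta> k) * X_coord a \<beta> m) + (a k)\<^sup>2"
    using assms law_of_cosines_angle[of "chain_end a \<beta> m" "a k" "\<beta> k"]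
    by (simp add: k chain_end_Suc Re_chain_end Im_chain_end)
  show ?thesis
  proof (cases "Phi a \<beta> m")
    case None
    thus ?thesis using law by (simp add: angle_relation_def k algebra_simps)
  next
    case (Some \<phi>)
    have "L m * sin_angle (\<beta> k + \<phi>)
        = sin_angle (\<beta> k) * Y_coord a \<beta> m + cos_angle (\<beta> k) * X_coord a \<beta> m"
      using chain_end_sin_add_Phi[OF Some] assms(3) by (simp add: k)
    with law have "(L k)\<^sup>2 = (L m)\<^sup>2 + 2 * a k * (L m * sin_angle (\<beta> k + \<phi>)) + (a k)\<^sup>2"
      by simp
    thus ?thesis using Some by (simp add: angle_relation_def k)
  qed
qed

lemma CConf_rotate:
  assumes "0 < a n" and \<beta>: "\<beta> \<in> CConf n a" and "2 \<le> n"
  shows "\<exists>\<gamma>\<in>CConf n a. \<gamma> 1 = \<theta> \<and> diag_vector n a \<gamma> = diag_vector n a \<beta>"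
proof -
  obtain \<delta> where \<delta>: "\<beta> 1 + \<delta> = \<theta>" using ex_angle_add by blast
  define \<gamma> where "\<gamma> = (\<lambda>i\<in>{1..n-1}. \<beta> i + \<delta>)"
  have len: "cmod (chain_end a \<gamma> k) = cmod (chain_end a \<beta> k)" if "k \<le> n - 1" for k
  proof -
    have "chain_end a \<gamma> k = chain_end a (\<lambda>i. \<beta> i + \<delta>) k"
      by (rule chain_end_cong) (use that in \<open>auto simp: \<gamma>_def\<close>)
    thus ?thesis by (simp add: chain_end_rotate norm_mult)
  qed
  have "\<gamma> \<in> CConf n a"
    using \<beta> len[of "n - 1"] assms(1) by (simp add: CConf_iff \<gamma>_def)
  moreover have "\<gamma> 1 = \<theta>"
    using \<delta> assms(3) by (auto simp: \<gamma>_def)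
  moreover have "diag_vector n a \<gamma> = diag_vector n a \<beta>"
    unfolding diag_vector_def by (rule restrict_ext) (use len in \<open>auto simp: diag_length_eq_cmod\<close>)
  ultimately show ?thesis by blast
qed

section \<open>Circular configurations and the diagonal space\<close>

theorem theorem2p1:
  fixes n :: nat and a :: "nat \<Rightarrow> real"
  assumes "4 \<le> n" and "\<And>i. i \<in> {1..n} \<Longrightarrow> 0 < a i"
  shows
    "(\<forall>\<beta>\<in>CConf n a. diag_vector n a \<beta> \<in> diag_space n a)
     \<and> (\<forall>L\<in>diag_space n a. \<exists>\<beta>\<in>CConf n a. \<forall>k\<in>{2..n-2}. diag_length a \<beta> k = L k)
     \<and> (\<forall>\<beta>\<in>CConf n a.
          (\<forall>k\<in>{1..n-1}. angle_relation a (all_diags n a (diag_vector n a \<beta>)) \<beta> k)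
        \<and> (\<forall>\<theta>. angle_relation a (all_diags n a (diag_vector n a \<beta>)) (\<beta>(1 := \<theta>)) 1)
        \<and> (\<forall>\<theta>. \<exists>\<gamma>\<in>CConf n a. \<gamma> 1 = \<theta> \<and> diag_vector n a \<gamma> = diag_vector n a \<beta>))"
proof (intro conjI ballI allI)
  show "diag_vector n a \<beta> \<in> diag_space n a" if "\<beta> \<in> CConf n a" for \<beta>
    using diag_vector_in_diag_space assms that by blast
  show "\<exists>\<beta>\<in>CConf n a. \<forall>k\<in>{2..n-2}. diag_length a \<beta> k = L k" if "L \<in> diag_space n a" for L
    using ex_CConf_with_diagonals assms that by blast
  show "angle_relation a (all_diags n a (diag_vector n a \<beta>)) \<beta> k"
    if "\<beta> \<in> CConf n a" and "k \<in> {1..n-1}" for \<beta> k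
    using assms that by (intro angle_relation_if_diagonals all_diags_diag_vector) auto
  show "angle_relation a (all_diags n a (diag_vector n a \<beta>)) (\<beta>(1 := \<theta>)) 1" for \<beta> \<theta>
    using assms(1) by (auto simp: angle_relation_def Phi_def all_diags_def)
  show "\<exists>\<gamma>\<in>CConf n a. \<gamma> 1 = \<theta> \<and> diag_vector n a \<gamma> = diag_vector n a \<beta>"
    if "\<beta> \<in> CConf n a" for \<beta> \<theta>
    using CConf_rotate[of a n \<beta> \<theta>] assms(1) assms(2)[of n] that by simp
qed

end
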